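(* Let $G$ be a finitely generated BC-group with uniformly bounded finite components, and let $p,q\in[1,\infty)$. Then every $G$-bounded derivation $d\colon f_p(G)\to \ell_q(G)$ is inner, i.e. there exists $x\in \ell_q(G)$ such that $d(a)=xa-ax$ for all $a\in\mathbb{C}[G]$.
   Context: $G$ is a finitely generated group with a fixed finite generating set $\mathscr{X}$. The conjugacy graph $\operatorname{sk}(G,\mathscr{X})$ has vertex set $G$, and for every $g\in G$ and $x\in\mathscr{X}\cup\mathscr{X}^{-1}$ an edge from $g$ to $xgx^{-1}$. The distance $\rho(g,h)$ is the minimal number of edges in a path from $g$ to $h$ ($\rho=\infty$ if there is no path). The connected components are exactly the conjugacy classes of $G$. $G$ is a BC-group (group with bounded conjugations) if for all $h_1,h_2\in G$ with $\rho(h_1,h_2)=1$ there exists $C>0$ such that $\rho(gh_1g^{-1},gh_2g^{-1})<C$ for all $g\in G$. "Uniformly bounded finite components" means: there is a constant $N$ such that every finite connected component of $\operatorname{sk}(G,\mathscr{X})$ has diameter (with respect to $\rho$) at most $N$. $f_p(G)$ is the group ring $\mathbb{C}[G]$ with the norm $\|\sum_g\alpha(g)g\|_p=(\sum_g|\alpha(g)|^p)^{1/p}$, and $\ell_q(G)$ is the completion of $\mathbb{C}[G]$ in the norm $\|\cdot\|_q$. It is a $\mathbb{C}[G]$-bimodule via left and right multiplication by group elements. A derivation $d\colon \mathbb{C}[G]\to M$ into a bimodule $M$ is a linear map with $d(ab)=d(a)b+a\,d(b)$; continuity is not assumed. A derivation $d\colon f_p(G)\to\ell_q(G)$ is $G$-bounded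 if $\sup_{g\in G}\|d(g)\|_q<\infty$. *)

theory Defs
  imports
    "HOL-Analysis.Analysis"
    "HOL-Algebra.Generated_Groups"
    "Graph_Theory.Digraph_Component"
    "Graph_Theory.Shortest_Path"
begin

section \<open>The conjugacy graph\<close>

definition sk :: "('a, 'b) monoid_scheme \<Rightarrow> 'a set \<Rightarrow> ('a, 'a \<times> 'a) pre_digraph" where
  "sk G X = \<lparr> verts = carrier G,
              arcs = carrier G \<times> (X \<union> m_inv G ` X),
              tail = fst,
              head = (\<lambda>(g, x). x \<otimes>\<^bsub>G\<^esub> g \<otimes>\<^bsub>G\<^esub> inv\<^bsub>G\<^esub> x) \<rparr>"

definition rho :: "('a, 'b) monoid_scheme \<Rightarrow> 'a set \<Rightarrow> 'a \<Rightarrow> 'a \<Rightarrow> ereal" where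
  "rho G X g h = wf_digraph.\<mu> (sk G X) (\<lambda>_. 1) g h"

definition bc_group :: "('a, 'b) monoid_scheme \<Rightarrow> 'a set \<Rightarrow> bool" where
  "bc_group G X \<longleftrightarrow> group G \<and>
     (\<forall>h1\<in>carrier G. \<forall>h2\<in>carrier G. rho G X h1 h2 = 1 \<longrightarrow>
        (\<exists>C::real. C > 0 \<and>
           (\<forall>g\<in>carrier G.
              rho G X (g \<otimes>\<^bsub>G\<^esub> h1 \<otimes>\<^bsub>G\<^esub> inv\<^bsub>G\<^esub> g) (g \<otimes>\<^bsub>G\<^esub> h2 \<otimes>\<^bsub>G\<^esub> inv\<^bsub>G\<^esub> g) < ereal C)))"

definition rho_diameter :: "('a, 'b) monoid_scheme \<Rightarrow> 'a set \<Rightarrow> 'a set \<Rightarrow> ereal" where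
  "rho_diameter G X K = (SUP g\<in>K. SUP h\<in>K. rho G X g h)"

text \<open>Every arc of the conjugacy graph can be traversed backwards (\<open>sk_symmetric\<close>), so that its
  strongly connected components are its connected components; they are the conjugacy classes
  (\<open>sk_components\<close>).\<close>

definition uniformly_bounded_finite_components ::
    "('a, 'b) monoid_scheme \<Rightarrow> 'a set \<Rightarrow> bool" where
  "uniformly_bounded_finite_components G X \<longleftrightarrow>
     (\<exists>N::real. \<forall>K \<in> pre_digraph.sccs_verts (sk G X).
        finite K \<longrightarrow> rho_diameter G X K \<le> ereal N)"

context group
begin

lemma sk_wf:
  assumes "X \<subseteq> carrier G"
  shows "wf_digraph (sk G X)"
  by unfold_locales (use assms in \<open>auto simp: sk_def\<close>)

lemma conj_mult:
  assumes "x \<in> carrier G" "y \<in> carrier G" "g \<in> carrier G"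
  shows "x \<otimes> (y \<otimes> g \<otimes> inv y) \<otimes> inv x = (x \<otimes> y) \<otimes> g \<otimes> inv (x \<otimes> y)"
  using assms by (simp add: m_assoc inv_mult_group)

lemma sk_dominates:
  assumes "X \<subseteq> carrier G"
  shows "g \<rightarrow>\<^bsub>sk G X\<^esub> h \<longleftrightarrow> g \<in> carrier G \<and> (\<exists>x \<in> X \<union> m_inv G ` X. h = x \<otimes> g \<otimes> inv x)"
  by (auto simp: sk_def arcs_ends_def arc_to_ends_def image_iff)

lemma sk_symmetric:
  assumes X: "X \<subseteq> carrier G"
  shows "symmetric (sk G X)"
  unfolding symmetric_def
proof (rule symI)
  fix g h assume "g \<rightarrow>\<^bsub>sk G X\<^esub> h"
  then obtain x where g: "g \<in> carrier G" and x: "x \<in> X \<union> m_inv G ` X"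
    and h: "h = x \<otimes> g \<otimes> inv x" using sk_dominates[OF X] by blast
  have xc: "x \<in> carrier G" using x X by auto
  have "inv x \<in> X \<union> m_inv G ` X" using x X by auto
  moreover have "g = inv x \<otimes> h \<otimes> inv (inv x)"
    unfolding h using g xc conj_mult[of "inv x" x g] by simp
  ultimately show "h \<rightarrow>\<^bsub>sk G X\<^esub> g"
    unfolding sk_dominates[OF X] using g xc h by (metis inv_closed m_closed)
qed

lemma sk_reachable:
  assumes X: "X \<subseteq> carrier G" and gen: "generate G X = carrier G"
  shows "g \<rightarrow>\<^sup>*\<^bsub>sk G X\<^esub> h \<longleftrightarrow> g \<in> carrier G \<and> (\<exists>x\<in>carrier G. h = x \<otimes> g \<otimes> inv x)"
proof
  interpret W: wf_digraph "sk G X" by (rule sk_wf[OF X])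
  assume "g \<rightarrow>\<^sup>*\<^bsub>sk G X\<^esub> h"
  then show "g \<in> carrier G \<and> (\<exists>x\<in>carrier G. h = x \<otimes> g \<otimes> inv x)"
  proof (induction rule: W.reachable_induct)
    case base
    then have "g \<in> carrier G" by (simp add: sk_def)
    then show ?case by (auto intro!: bexI[of _ \<one>])
  next
    case (step h k)
    obtain y where y': "y \<in> X \<union> m_inv G ` X" "k = y \<otimes> h \<otimes> inv y"
      using step(2) unfolding sk_dominates[OF X] by (elim conjE bexE)
    obtain x where x: "g \<in> carrier G" "x \<in> carrier G" "h = x \<otimes> g \<otimes> inv x"
      using step(3) by (elim conjE bexE)
    have y: "y \<in> carrier G" using y'(1) X by auto
    have "k = (y \<otimes> x) \<otimes> g \<otimes> inv (y \<otimes> x)"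
      unfolding y'(2) x(3) by (rule conj_mult[OF y x(2) x(1)])
    then show ?case using x(1,2) y by (intro conjI bexI[of _ "y \<otimes> x"] m_closed)
  qed
next
  interpret W: wf_digraph "sk G X" by (rule sk_wf[OF X])
  have *: "g \<rightarrow>\<^sup>*\<^bsub>sk G X\<^esub> (x \<otimes> g \<otimes> inv x)" if "x \<in> generate G X" "g \<in> carrier G" for x g
    using that
  proof (induction arbitrary: g rule: generate.induct)
    case one
    then show ?case using W.reachable_refl[of g] by (simp add: sk_def)
  next
    case (incl x)
    then show ?case using sk_dominates[OF X] by (intro W.reachable_adjI) auto
  next
    case (inv y)
    then show ?case using sk_dominates[OF X] X by (intro W.reachable_adjI) auto
  next
    case (eng x y)
    have c: "x \<in> carrier G" "y \<in> carrier G" using eng gen by auto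
    have "g \<rightarrow>\<^sup>*\<^bsub>sk G X\<^esub> (y \<otimes> g \<otimes> inv y)" using eng by blast
    also have "\<dots> \<rightarrow>\<^sup>*\<^bsub>sk G X\<^esub> (x \<otimes> (y \<otimes> g \<otimes> inv y) \<otimes> inv x)" using eng c by simp
    finally show ?case using conj_mult c eng.prems by simp
  qed
  assume "g \<in> carrier G \<and> (\<exists>x\<in>carrier G. h = x \<otimes> g \<otimes> inv x)"
  then show "g \<rightarrow>\<^sup>*\<^bsub>sk G X\<^esub> h" using * gen by auto
qed

lemma sk_components:
  assumes X: "X \<subseteq> carrier G" and gen: "generate G X = carrier G"
  shows "pre_digraph.sccs_verts (sk G X) =
    (\<lambda>g. {x \<otimes> g \<otimes> inv x | x. x \<in> carrier G}) ` carrier G"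
proof -
  interpret W: wf_digraph "sk G X" by (rule sk_wf[OF X])
  define R where "R g h \<longleftrightarrow> g \<rightarrow>\<^sup>*\<^bsub>sk G X\<^esub> h" for g h
  have sym: "R g h \<Longrightarrow> R h g" for g h
    unfolding R_def using symmetric_reachable[OF sk_symmetric[OF X]] by blast
  have trans: "R g h \<Longrightarrow> R h k \<Longrightarrow> R g k" for g h k
    unfolding R_def by (rule W.reachable_trans)
  have refl: "R g g" if "g \<in> carrier G" for g
    unfolding R_def using that W.reachable_refl[of g] by (simp add: sk_def)
  have R: "R g h \<longleftrightarrow> g \<in> carrier G \<and> (\<exists>x\<in>carrier G. h = x \<otimes> g \<otimes> inv x)" for g h
    unfolding R_def by (rule sk_reachable[OF X gen])
  have cls: "{x \<otimes> g \<otimes> inv x | x. x \<in> carrier G} = {h. R g h}" if "g \<in> carrier G" for g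
    using R that by auto
  have "pre_digraph.sccs_verts (sk G X) = (\<lambda>g. {h. R g h}) ` carrier G"
  proof (intro equalityI subsetI)
    fix S assume "S \<in> pre_digraph.sccs_verts (sk G X)"
    then have S: "S \<noteq> {}" "\<And>u v. u \<in> S \<Longrightarrow> v \<in> S \<Longrightarrow> R u v"
      "\<And>u v. u \<in> S \<Longrightarrow> v \<notin> S \<Longrightarrow> \<not> R u v \<or> \<not> R v u"
      unfolding W.sccs_verts_def R_def by auto
    then obtain g where g: "g \<in> S" by blast
    then have "g \<in> carrier G" using S(2) R by blast
    moreover have "S = {h. R g h}" using g S sym by blast
    ultimately show "S \<in> (\<lambda>g. {h. R g h}) ` carrier G" by blast
  next
    fix S assume "S \<in> (\<lambda>g. {h. R g h}) ` carrier G"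
    then obtain g where "g \<in> carrier G" "S = {h. R g h}" by blast
    then show "S \<in> pre_digraph.sccs_verts (sk G X)"
      unfolding W.sccs_verts_def R_def[symmetric] using refl sym trans by blast
  qed
  then show ?thesis using cls by auto
qed

end

section \<open>The group ring and the spaces \<open>f_p(G)\<close> and \<open>\<ell>_q(G)\<close>\<close>

text \<open>Formal combinations of the elements of \<open>G\<close> are functions on the underlying type that vanish
  outside of \<open>carrier G\<close>.\<close>

record 'v normed_carrier =
  vecs :: "'v set"
  nrm :: "'v \<Rightarrow> real"

definition lp_norm :: "('a, 'b) monoid_scheme \<Rightarrow> real \<Rightarrow> ('a \<Rightarrow> complex) \<Rightarrow> real" where
  "lp_norm G p f = (\<Sum>\<^sub>\<infinity>g\<in>carrier G. cmod (f g) powr p) powr (1 / p)"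

definition group_ring :: "('a, 'b) monoid_scheme \<Rightarrow> ('a \<Rightarrow> complex) set" where
  "group_ring G = {a. finite {g. a g \<noteq> 0} \<and> {g. a g \<noteq> 0} \<subseteq> carrier G}"

definition delta :: "'a \<Rightarrow> 'a \<Rightarrow> complex" where
  "delta g = (\<lambda>h. if h = g then 1 else 0)"

definition gr_mult ::
    "('a, 'b) monoid_scheme \<Rightarrow> ('a \<Rightarrow> complex) \<Rightarrow> ('a \<Rightarrow> complex) \<Rightarrow> 'a \<Rightarrow> complex" where
  "gr_mult G a b =
     (\<lambda>k. \<Sum>g | a g \<noteq> 0. \<Sum>h | b h \<noteq> 0. a g * b h * delta (g \<otimes>\<^bsub>G\<^esub> h) k)"

definition fp :: "('a, 'b) monoid_scheme \<Rightarrow> real \<Rightarrow> ('a \<Rightarrow> complex) normed_carrier" where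
  "fp G p = \<lparr> vecs = group_ring G, nrm = lp_norm G p \<rparr>"

text \<open>The completion of the group ring in the \<open>q\<close>-norm, realised as the space of \<open>q\<close>-summable
  functions: \<open>lp_norm_triangle\<close>, \<open>group_ring_dense\<close> and \<open>ell_complete\<close> below show that this is a
  complete normed space in which the group ring is dense.\<close>

definition ell :: "('a, 'b) monoid_scheme \<Rightarrow> real \<Rightarrow> ('a \<Rightarrow> complex) normed_carrier" where
  "ell G q = \<lparr> vecs = {f. {g. f g \<noteq> 0} \<subseteq> carrier G \<and>
                          (\<lambda>g. cmod (f g) powr q) summable_on carrier G},
               nrm = lp_norm G q \<rparr>"

text \<open>The left and right module actions of the group ring, extending linearly
  \<open>(g f)(k) = f(g\<inverse> k)\<close> and \<open>(f g)(k) = f(k g\<inverse>)\<close>.\<close>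

definition lact ::
    "('a, 'b) monoid_scheme \<Rightarrow> ('a \<Rightarrow> complex) \<Rightarrow> ('a \<Rightarrow> complex) \<Rightarrow> 'a \<Rightarrow> complex" where
  "lact G a f =
     (\<lambda>k. if k \<in> carrier G then \<Sum>g | a g \<noteq> 0. a g * f (inv\<^bsub>G\<^esub> g \<otimes>\<^bsub>G\<^esub> k) else 0)"

definition ract ::
    "('a, 'b) monoid_scheme \<Rightarrow> ('a \<Rightarrow> complex) \<Rightarrow> ('a \<Rightarrow> complex) \<Rightarrow> 'a \<Rightarrow> complex" where
  "ract G f a =
     (\<lambda>k. if k \<in> carrier G then \<Sum>g | a g \<noteq> 0. f (k \<otimes>\<^bsub>G\<^esub> inv\<^bsub>G\<^esub> g) * a g else 0)"

section \<open>Derivations\<close>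

definition derivation ::
    "('a, 'b) monoid_scheme \<Rightarrow> ('a \<Rightarrow> complex) normed_carrier \<Rightarrow> ('a \<Rightarrow> complex) normed_carrier
      \<Rightarrow> (('a \<Rightarrow> complex) \<Rightarrow> 'a \<Rightarrow> complex) \<Rightarrow> bool" where
  "derivation G A M d \<longleftrightarrow>
     (\<forall>a\<in>vecs A. d a \<in> vecs M) \<and>
     (\<forall>a\<in>vecs A. \<forall>b\<in>vecs A. d (\<lambda>k. a k + b k) = (\<lambda>k. d a k + d b k)) \<and>
     (\<forall>c. \<forall>a\<in>vecs A. d (\<lambda>k. c * a k) = (\<lambda>k. c * d a k)) \<and>
     (\<forall>a\<in>vecs A. \<forall>b\<in>vecs A. d (gr_mult G a b) = (\<lambda>k. ract G (d a) b k + lact G a (d b) k))"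

definition G_bounded ::
    "('a, 'b) monoid_scheme \<Rightarrow> ('a \<Rightarrow> complex) normed_carrier
      \<Rightarrow> (('a \<Rightarrow> complex) \<Rightarrow> 'a \<Rightarrow> complex) \<Rightarrow> bool" where
  "G_bounded G M d \<longleftrightarrow> bdd_above ((\<lambda>g. nrm M (d (delta g))) ` carrier G)"

section \<open>Consistency of the definitions\<close>

context group
begin

lemma lact_delta:
  assumes "g \<in> carrier G"
  shows "lact G (delta g) f = (\<lambda>k. if k \<in> carrier G then f (inv g \<otimes> k) else 0)"
  by (auto simp: lact_def delta_def)

lemma ract_delta:
  assumes "g \<in> carrier G"
  shows "ract G f (delta g) = (\<lambda>k. if k \<in> carrier G then f (k \<otimes> inv g) else 0)"
  by (auto simp: ract_def delta_def)

lemma gr_mult_delta: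
  "gr_mult G (delta g) (delta h) = delta (g \<otimes> h)"
  by (auto simp: gr_mult_def delta_def fun_eq_iff)

lemma gr_mult_eq_lact:
  assumes a: "a \<in> group_ring G" and b: "b \<in> group_ring G"
  shows "gr_mult G a b = lact G a b"
proof
  fix k
  have ca: "a g \<noteq> 0 \<Longrightarrow> g \<in> carrier G" and cb: "b g \<noteq> 0 \<Longrightarrow> g \<in> carrier G" for g
    using a b by (auto simp: group_ring_def)
  have fb: "finite {h. b h \<noteq> 0}" using b by (simp add: group_ring_def)
  have *: "(\<Sum>h | b h \<noteq> 0. a g * b h * delta (g \<otimes> h) k) =
      (if k \<in> carrier G then a g * b (inv g \<otimes> k) else 0)" if g: "a g \<noteq> 0" for g
  proof (cases "k \<in> carrier G")
    case True
    have "(\<Sum>h | b h \<noteq> 0. a g * b h * delta (g \<otimes> h) k) =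
        (\<Sum>h | b h \<noteq> 0. if h = inv g \<otimes> k then a g * b h else 0)"
      using True ca[OF g] cb
      by (intro sum.cong) (auto simp: delta_def inv_solve_left)
    also have "\<dots> = a g * b (inv g \<otimes> k)" using fb by (simp add: sum.delta)
    finally show ?thesis using True by simp
  next
    case False
    then show ?thesis using ca[OF g] cb by (auto simp: delta_def intro!: sum.neutral)
  qed
  show "gr_mult G a b k = lact G a b k"
    unfolding gr_mult_def lact_def using * by (auto intro!: sum.cong sum.neutral)
qed

lemma gr_mult_eq_ract:
  assumes a: "a \<in> group_ring G" and b: "b \<in> group_ring G"
  shows "gr_mult G a b = ract G a b"
proof
  fix k
  have ca: "a g \<noteq> 0 \<Longrightarrow> g \<in> carrier G" and cb: "b g \<noteq> 0 \<Longrightarrow> g \<in> carrier G" for g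
    using a b by (auto simp: group_ring_def)
  have fa: "finite {h. a h \<noteq> 0}" using a by (simp add: group_ring_def)
  have *: "(\<Sum>g | a g \<noteq> 0. a g * b h * delta (g \<otimes> h) k) =
      (if k \<in> carrier G then a (k \<otimes> inv h) * b h else 0)" if h: "b h \<noteq> 0" for h
  proof (cases "k \<in> carrier G")
    case True
    have "(\<Sum>g | a g \<noteq> 0. a g * b h * delta (g \<otimes> h) k) =
        (\<Sum>g | a g \<noteq> 0. if g = k \<otimes> inv h then a g * b h else 0)"
      using True ca cb[OF h]
      by (intro sum.cong) (auto simp: delta_def inv_solve_right)
    also have "\<dots> = a (k \<otimes> inv h) * b h" using fa by (simp add: sum.delta)
    finally show ?thesis using True by simp
  next
    case False
    then show ?thesis using cb[OF h] ca by (auto simp: delta_def intro!: sum.neutral)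
  qed
  show "gr_mult G a b k = ract G a b k"
    unfolding gr_mult_def ract_def
    using * by (subst sum.swap) (auto intro!: sum.cong sum.neutral)
qed

end

lemma lp_norm_group_ring:
  assumes "a \<in> group_ring G"
  shows "lp_norm G p a = (\<Sum>g | a g \<noteq> 0. cmod (a g) powr p) powr (1 / p)"
proof -
  have "(\<Sum>\<^sub>\<infinity>g\<in>carrier G. cmod (a g) powr p) = (\<Sum>\<^sub>\<infinity>g | a g \<noteq> 0. cmod (a g) powr p)"
    using assms by (intro infsum_cong_neutral) (auto simp: group_ring_def)
  also have "\<dots> = (\<Sum>g | a g \<noteq> 0. cmod (a g) powr p)"
    using assms by (intro infsum_finite) (simp add: group_ring_def)
  finally show ?thesis by (simp add: lp_norm_def)
qed

lemma lp_norm_nonneg: "lp_norm G p f \<ge> 0"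
  by (simp add: lp_norm_def)

lemma vecs_ell: "f \<in> vecs (ell G p) \<longleftrightarrow>
    {g. f g \<noteq> 0} \<subseteq> carrier G \<and> (\<lambda>g. cmod (f g) powr p) summable_on carrier G"
  by (simp add: ell_def)

lemma sum_le_lp_norm:
  assumes f: "f \<in> vecs (ell G p)" and F: "finite F" "F \<subseteq> carrier G" and p: "1 \<le> p"
  shows "(\<Sum>g\<in>F. cmod (f g) powr p) \<le> lp_norm G p f powr p"
proof -
  have "(\<Sum>g\<in>F. cmod (f g) powr p) \<le> (\<Sum>\<^sub>\<infinity>g\<in>carrier G. cmod (f g) powr p)"
    using f F by (intro finite_sum_le_infsum) (auto simp: vecs_ell)
  also have "\<dots> = lp_norm G p f powr p"
    unfolding lp_norm_def using p by (simp add: powr_powr infsum_nonneg)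
  finally show ?thesis .
qed

lemma lp_norm_leI:
  assumes supp: "{g. f g \<noteq> 0} \<subseteq> carrier G" and p: "1 \<le> p" and C: "0 \<le> C"
    and le: "\<And>F. finite F \<Longrightarrow> F \<subseteq> carrier G \<Longrightarrow> (\<Sum>g\<in>F. cmod (f g) powr p) \<le> C powr p"
  shows "f \<in> vecs (ell G p)" "lp_norm G p f \<le> C"
proof -
  have summ: "(\<lambda>g. cmod (f g) powr p) summable_on carrier G"
    by (rule nonneg_bdd_above_summable_on) (use le in \<open>auto intro!: bdd_aboveI2\<close>)
  then show "f \<in> vecs (ell G p)" using supp by (simp add: vecs_ell)
  have "(\<Sum>\<^sub>\<infinity>g\<in>carrier G. cmod (f g) powr p) \<le> C powr p"
    using summ le by (intro infsum_le_finite_sums) auto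
  then have "lp_norm G p f \<le> (C powr p) powr (1 / p)"
    unfolding lp_norm_def using p by (intro powr_mono2) (auto intro: infsum_nonneg)
  then show "lp_norm G p f \<le> C" using p C by (simp add: powr_powr)
qed

lemma cmod_le_lp_norm:
  assumes f: "f \<in> vecs (ell G p)" and p: "1 \<le> p"
  shows "cmod (f g) \<le> lp_norm G p f"
proof (cases "g \<in> carrier G")
  case True
  then have "cmod (f g) powr p \<le> lp_norm G p f powr p"
    using sum_le_lp_norm[OF f, of "{g}"] p by simp
  then show ?thesis
    using powr_less_mono2[of p "lp_norm G p f" "cmod (f g)"] p lp_norm_nonneg[of G p f]
    by linarith
next
  case False
  then have "f g = 0" using f by (auto simp: vecs_ell)
  then show ?thesis by (simp add: lp_norm_nonneg)
qed

lemma lp_norm_eq_0_iff: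
  assumes "f \<in> vecs (ell G p)" "1 \<le> p"
  shows "lp_norm G p f = 0 \<longleftrightarrow> f = (\<lambda>g. 0)"
proof
  assume "lp_norm G p f = 0"
  then show "f = (\<lambda>g. 0)" using cmod_le_lp_norm[OF assms] by auto
qed (simp add: lp_norm_def)

lemma lp_norm_scale:
  assumes f: "f \<in> vecs (ell G p)" and p: "1 \<le> p"
  shows "(\<lambda>g. c * f g) \<in> vecs (ell G p)" "lp_norm G p (\<lambda>g. c * f g) = cmod c * lp_norm G p f"
proof -
  show "(\<lambda>g. c * f g) \<in> vecs (ell G p)"
    using f by (auto simp: vecs_ell norm_mult powr_mult intro!: summable_on_cmult_right)
  show "lp_norm G p (\<lambda>g. c * f g) = cmod c * lp_norm G p f"
    using p unfolding lp_norm_def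
    by (simp add: norm_mult powr_mult infsum_cmult_right' powr_powr infsum_nonneg)
qed

lemma powr_convex_combination:
  fixes x y s t p :: real
  assumes "1 \<le> p" "0 \<le> x" "0 \<le> y" "0 < s" "0 < t" "s + t = 1"
  shows "(s * x + t * y) powr p \<le> s * x powr p + t * y powr p"
proof -
  have le: "u powr p \<le> u" if "0 < u" "u \<le> 1" for u :: real
    using powr_mono'[of 1 p u] that assms(1) by simp
  consider "x = 0" | "y = 0" | "0 < x" "0 < y" using assms by linarith
  then show ?thesis
  proof cases
    case 1
    then show ?thesis using assms le[of t] by (simp add: powr_mult mult_right_mono)
  next
    case 2
    then show ?thesis using assms le[of s] by (simp add: powr_mult mult_right_mono)
  next
    case 3
    have s: "s = 1 - t" using assms by simp
    show ?thesis
      using convex_onD[OF powr_convex[OF assms(1)], of t x y] 3 assms by (simp add: s)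
  qed
qed

lemma lp_norm_triangle:
  assumes f: "f \<in> vecs (ell G p)" and h: "h \<in> vecs (ell G p)" and p: "1 \<le> p"
  shows "(\<lambda>g. f g + h g) \<in> vecs (ell G p)"
    "lp_norm G p (\<lambda>g. f g + h g) \<le> lp_norm G p f + lp_norm G p h"
proof -
  have supp: "{g. f g + h g \<noteq> 0} \<subseteq> carrier G"
  proof -
    have "{g. f g + h g \<noteq> 0} \<subseteq> {g. f g \<noteq> 0} \<union> {g. h g \<noteq> 0}" by auto
    then show ?thesis using f h unfolding vecs_ell by blast
  qed
  have key: "(\<Sum>g\<in>F. cmod (f g + h g) powr p) \<le> (lp_norm G p f + lp_norm G p h + e) powr p"
    if F: "finite F" "F \<subseteq> carrier G" and e: "0 < e" for F e
  proof -
    define A where "A = lp_norm G p f + e / 2"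
    define B where "B = lp_norm G p h + e / 2"
    have A: "0 < A" "lp_norm G p f \<le> A" and B: "0 < B" "lp_norm G p h \<le> B"
      using e lp_norm_nonneg[of G p f] lp_norm_nonneg[of G p h] by (auto simp: A_def B_def)
    have one: "(\<Sum>g\<in>F. (cmod (k g) / D) powr p) \<le> 1"
      if "k \<in> vecs (ell G p)" "0 < D" "lp_norm G p k \<le> D" for k D
    proof -
      have "(\<Sum>g\<in>F. (cmod (k g) / D) powr p) = (\<Sum>g\<in>F. cmod (k g) powr p) / D powr p"
        using that by (simp add: powr_divide sum_divide_distrib)
      also have "\<dots> \<le> D powr p / D powr p"
        using sum_le_lp_norm[OF that(1) F p] powr_mono2[of p "lp_norm G p k" D] that p
        by (intro divide_right_mono) (auto simp: lp_norm_nonneg)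
      finally show ?thesis using that by simp
    qed
    have pt: "cmod (f g + h g) powr p \<le> (A + B) powr p *
        (A / (A + B) * (cmod (f g) / A) powr p + B / (A + B) * (cmod (h g) / B) powr p)" for g
    proof -
      have "cmod (f g + h g) powr p \<le> (cmod (f g) + cmod (h g)) powr p"
        using p by (intro powr_mono2) (auto intro: norm_triangle_ineq)
      also have "cmod (f g) + cmod (h g) =
          (A + B) * (A / (A + B) * (cmod (f g) / A) + B / (A + B) * (cmod (h g) / B))"
        using A B by (simp add: distrib_left)
      also have "\<dots> powr p = (A + B) powr p *
          (A / (A + B) * (cmod (f g) / A) + B / (A + B) * (cmod (h g) / B)) powr p"
        using A B by (intro powr_mult)
      also have "\<dots> \<le> (A + B) powr p *
          (A / (A + B) * (cmod (f g) / A) powr p + B / (A + B) * (cmod (h g) / B) powr p)"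
        using A B p by (intro mult_left_mono powr_convex_combination)
            (auto simp: add_divide_distrib[symmetric])
      finally show ?thesis .
    qed
    have "(\<Sum>g\<in>F. cmod (f g + h g) powr p) \<le> (\<Sum>g\<in>F. (A + B) powr p *
        (A / (A + B) * (cmod (f g) / A) powr p + B / (A + B) * (cmod (h g) / B) powr p))"
      by (intro sum_mono pt)
    also have "\<dots> = (A + B) powr p *
        (A / (A + B) * (\<Sum>g\<in>F. (cmod (f g) / A) powr p) +
         B / (A + B) * (\<Sum>g\<in>F. (cmod (h g) / B) powr p))"
      by (simp only: sum_distrib_left sum.distrib distrib_left)
    also have "\<dots> \<le> (A + B) powr p * (A / (A + B) * 1 + B / (A + B) * 1)"
      using A B one[OF f A] one[OF h B]
      by (intro mult_left_mono add_mono) auto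
    also have "\<dots> = (A + B) powr p" using A B by (simp add: add_divide_distrib[symmetric])
    finally show ?thesis by (simp add: A_def B_def algebra_simps)
  qed
  have nn: "0 \<le> lp_norm G p f + lp_norm G p h" by (simp add: lp_norm_nonneg)
  show "(\<lambda>g. f g + h g) \<in> vecs (ell G p)"
    using lp_norm_leI(1)[OF supp p, of "lp_norm G p f + lp_norm G p h + 1"] key[of _ 1] nn by simp
  show "lp_norm G p (\<lambda>g. f g + h g) \<le> lp_norm G p f + lp_norm G p h"
  proof (rule field_le_epsilon)
    fix e :: real assume e: "0 < e"
    show "lp_norm G p (\<lambda>g. f g + h g) \<le> lp_norm G p f + lp_norm G p h + e"
      by (rule lp_norm_leI(2)[OF supp p _ key[OF _ _ e]]) (use nn e in auto)
  qed
qed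

lemma lp_norm_diff:
  assumes f: "f \<in> vecs (ell G p)" and h: "h \<in> vecs (ell G p)" and p: "1 \<le> p"
  shows "(\<lambda>g. f g - h g) \<in> vecs (ell G p)"
  using lp_norm_triangle(1)[OF f lp_norm_scale(1)[OF h p, of "-1"] p] by simp

lemma group_ring_subset_ell: "group_ring G \<subseteq> vecs (ell G p)"
proof
  fix a assume a: "a \<in> group_ring G"
  then have "(\<lambda>g. cmod (a g) powr p) summable_on {g. a g \<noteq> 0}"
    by (intro summable_on_finite) (simp add: group_ring_def)
  then have "(\<lambda>g. cmod (a g) powr p) summable_on carrier G"
    by (rule iffD1[OF summable_on_cong_neutral, rotated 3]) (use a in \<open>auto simp: group_ring_def\<close>)
  then show "a \<in> vecs (ell G p)" using a by (simp add: vecs_ell group_ring_def)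
qed

lemma group_ring_dense:
  assumes f: "f \<in> vecs (ell G p)" and p: "1 \<le> p" and e: "0 < e"
  shows "\<exists>a\<in>group_ring G. lp_norm G p (\<lambda>g. f g - a g) \<le> e"
proof -
  let ?w = "\<lambda>g. cmod (f g) powr p"
  have summ: "?w summable_on carrier G" using f by (simp add: vecs_ell)
  obtain F where F: "finite F" "F \<subseteq> carrier G"
    "dist (sum ?w F) (infsum ?w (carrier G)) \<le> e powr p"
    using infsum_finite_approximation[OF summ, of "e powr p"] e by auto
  define a where "a = (\<lambda>g. if g \<in> F then f g else 0)"
  have a: "a \<in> group_ring G" using F by (auto simp: group_ring_def a_def)
  have "lp_norm G p (\<lambda>g. f g - a g) \<le> e"
  proof (rule lp_norm_leI(2))
    show "{g. f g - a g \<noteq> 0} \<subseteq> carrier G" using f by (auto simp: vecs_ell a_def)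
  next
    fix H assume H: "finite H" "H \<subseteq> carrier G"
    have "(\<Sum>g\<in>H. cmod (f g - a g) powr p) = sum ?w (H - F)"
      using H by (intro sum.mono_neutral_cong_right) (auto simp: a_def)
    also have "\<dots> = sum ?w (F \<union> H) - sum ?w F"
      using F H by (subst sum_diff[symmetric]) (auto intro: arg_cong2[where f = sum])
    also have "sum ?w (F \<union> H) \<le> infsum ?w (carrier G)"
      using F H summ by (intro finite_sum_le_infsum) auto
    finally show "(\<Sum>g\<in>H. cmod (f g - a g) powr p) \<le> e powr p"
      using F(3) by (simp add: dist_real_def)
  qed (use p e in auto)
  then show ?thesis using a by blast
qed

lemma ell_complete:
  assumes p: "1 \<le> p" and u: "\<And>n::nat. u n \<in> vecs (ell G p)"
    and Cauchy: "\<And>e. 0 < e \<Longrightarrow> \<exists>N. \<forall>m\<ge>N. \<forall>n\<ge>N. lp_norm G p (\<lambda>g. u m g - u n g) < e"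
  shows "\<exists>f\<in>vecs (ell G p). (\<lambda>n. lp_norm G p (\<lambda>g. u n g - f g)) \<longlonglongrightarrow> 0"
proof -
  have diff: "(\<lambda>g. u m g - u n g) \<in> vecs (ell G p)" for m n
    by (rule lp_norm_diff[OF u u p])
  have "Cauchy (\<lambda>n. u n g)" for g
  proof (rule metric_CauchyI)
    fix e :: real assume "0 < e"
    then obtain N where N: "\<forall>m\<ge>N. \<forall>n\<ge>N. lp_norm G p (\<lambda>g. u m g - u n g) < e"
      using Cauchy by blast
    have "dist (u m g) (u n g) < e" if "m \<ge> N" "n \<ge> N" for m n
      using N that cmod_le_lp_norm[OF diff[of m n] p, of g] by (force simp: dist_norm)
    then show "\<exists>N. \<forall>m\<ge>N. \<forall>n\<ge>N. dist (u m g) (u n g) < e" by blast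
  qed
  then have "\<forall>g. \<exists>l. (\<lambda>n. u n g) \<longlonglongrightarrow> l" by (simp add: Cauchy_convergent_iff convergent_def)
  then obtain f where lim: "\<And>g. (\<lambda>n. u n g) \<longlonglongrightarrow> f g" by metis
  have f0: "f g = 0" if "g \<notin> carrier G" for g
  proof -
    have "u n g = 0" for n using u that by (auto simp: vecs_ell)
    then show ?thesis using lim[of g] by (simp add: LIMSEQ_const_iff)
  qed
  have supp: "{g. u n g - f g \<noteq> 0} \<subseteq> carrier G" for n
    using f0 u[of n] by (force simp: vecs_ell)
  have near: "\<exists>N. \<forall>n\<ge>N. (\<lambda>g. u n g - f g) \<in> vecs (ell G p) \<and>
      lp_norm G p (\<lambda>g. u n g - f g) \<le> e" if e: "0 < e" for e
  proof -
    obtain N where N: "\<forall>m\<ge>N. \<forall>n\<ge>N. lp_norm G p (\<lambda>g. u m g - u n g) < e"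
      using Cauchy[OF e] by blast
    have "(\<Sum>g\<in>F. cmod (u n g - f g) powr p) \<le> e powr p"
      if F: "finite F" "F \<subseteq> carrier G" and n: "n \<ge> N" for F n
    proof (rule LIMSEQ_le_const2)
      show "(\<lambda>m. \<Sum>g\<in>F. cmod (u n g - u m g) powr p) \<longlonglongrightarrow> (\<Sum>g\<in>F. cmod (u n g - f g) powr p)"
        using p by (intro tendsto_sum tendsto_powr2 tendsto_norm tendsto_diff tendsto_const lim) auto
      have "(\<Sum>g\<in>F. cmod (u n g - u m g) powr p) \<le> e powr p" if "m \<ge> N" for m
      proof -
        have "(\<Sum>g\<in>F. cmod (u n g - u m g) powr p) \<le> lp_norm G p (\<lambda>g. u n g - u m g) powr p"
          by (rule sum_le_lp_norm[OF diff F p])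
        also have "\<dots> \<le> e powr p"
          using N n that p by (intro powr_mono2) (auto simp: lp_norm_nonneg less_imp_le)
        finally show ?thesis .
      qed
      then show "\<exists>M. \<forall>m\<ge>M. (\<Sum>g\<in>F. cmod (u n g - u m g) powr p) \<le> e powr p" by blast
    qed
    then show ?thesis using lp_norm_leI[OF supp p, of e] e by (intro exI[of _ N]) auto
  qed
  obtain n where "(\<lambda>g. u n g - f g) \<in> vecs (ell G p)" using near[of 1] by auto
  then have "f \<in> vecs (ell G p)" using lp_norm_diff[OF u[of n] _ p] by fastforce
  moreover have "(\<lambda>n. lp_norm G p (\<lambda>g. u n g - f g)) \<longlonglongrightarrow> 0"
  proof (rule LIMSEQ_I)
    fix r :: real assume r: "0 < r"
    then obtain N where "\<forall>n\<ge>N. lp_norm G p (\<lambda>g. u n g - f g) \<le> r / 2" using near[of "r / 2"] by auto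
    then show "\<exists>N. \<forall>n\<ge>N. norm (lp_norm G p (\<lambda>g. u n g - f g) - 0) < r"
      using r by (intro exI[of _ N]) (fastforce simp: lp_norm_nonneg)
  qed
  ultimately show ?thesis by blast
qed

end

theory Submission
  imports Defs
begin

text \<open>Write \<open>\<phi> g = d(g) g\<inverse>\<close>. The Leibniz rule says that \<open>\<phi>\<close> is a 1-cocycle for the
  isometric action of \<open>G\<close> on \<open>\<ell>\<^sub>q(G)\<close> by conjugation, \<open>G\<close>-boundedness says that \<open>\<phi>\<close> is bounded in
  norm, and \<open>d\<close> is inner as soon as \<open>\<phi>\<close> is the coboundary of some \<open>x\<close> in \<open>\<ell>\<^sub>q(G)\<close>.

  As a mere function on \<open>G\<close>, such an \<open>x\<close> always exists (\<open>ex_potential\<close>): the only obstruction is the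
  restriction of \<open>\<phi>\<close> to the stabilizers, where it is a bounded homomorphism into the complex
  numbers, hence zero. It is unique up to a constant on each conjugacy class, and the task is to choose
  the constants so that \<open>x\<close> becomes \<open>q\<close>-summable.

  On an infinite class the constant has to be the limit \<open>c\<close> of \<open>x\<close> at infinity. That there is one is
  due to bounded conjugations (\<open>ex_limit_on_infinite_class\<close>): if \<open>g\<^sub>n\<close> moves one point of the class to
  infinity and \<open>x\<close> converges along this motion, then two conjugate points are moved by \<open>g\<^sub>n\<close> to points
  that differ by conjugation with an element of a fixed finite set, and the increment of \<open>x\<close> between
  them tends to 0 since every \<open>\<phi> w\<close> is in \<open>\<ell>\<^sub>q\<close>. So \<open>x\<close> tends to \<open>c\<close> along \<open>g\<^sub>n\<close> from every point of
  the class, and \<open>x - c\<close> is a pointwise limit of the bounded family \<open>\<phi> (g\<^sub>n\<inverse>)\<close>. The infinite classes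
  are treated together by moving any finite set of points to infinity at once
  (\<open>conjugate_off_finite_set\<close>, \<open>infinite_classes_bound\<close>).

  On a finite class the constant can be the value of \<open>x\<close> at any point. Because the finite classes have
  uniformly bounded diameter, all points of all finite classes reach the chosen points through a single
  finite set \<open>W\<close> of conjugators, and the \<open>q\<close>-th power of the norm is at most \<open>card W\<close> times the bound
  for \<open>\<phi>\<close> (\<open>finite_classes_bound\<close>).\<close>

section \<open>Distances and conjugators\<close>

definition conj_by :: "('a, 'b) monoid_scheme \<Rightarrow> 'a \<Rightarrow> 'a \<Rightarrow> 'a" where
  "conj_by G g k = g \<otimes>\<^bsub>G\<^esub> k \<otimes>\<^bsub>G\<^esub> inv\<^bsub>G\<^esub> g"

definition conj_class :: "('a, 'b) monoid_scheme \<Rightarrow> 'a \<Rightarrow> 'a set" where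
  "conj_class G k = (\<lambda>g. conj_by G g k) ` carrier G"

context group
begin

lemma conj_by_closed [simp]:
  "g \<in> carrier G \<Longrightarrow> k \<in> carrier G \<Longrightarrow> conj_by G g k \<in> carrier G"
  by (simp add: conj_by_def)

lemma conj_by_one [simp]: "k \<in> carrier G \<Longrightarrow> conj_by G \<one> k = k"
  by (simp add: conj_by_def)

lemma conj_by_mult:
  "g \<in> carrier G \<Longrightarrow> h \<in> carrier G \<Longrightarrow> k \<in> carrier G \<Longrightarrow>
    conj_by G (g \<otimes> h) k = conj_by G g (conj_by G h k)"
  by (simp add: conj_by_def conj_mult)

lemma conj_by_inv [simp]:
  assumes "g \<in> carrier G" "k \<in> carrier G"
  shows "conj_by G (inv g) (conj_by G g k) = k" "conj_by G g (conj_by G (inv g) k) = k"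
  using assms by (simp_all flip: conj_by_mult)

lemma conj_by_inj: "g \<in> carrier G \<Longrightarrow> inj_on (conj_by G g) (carrier G)"
  by (rule inj_on_inverseI[where g = "conj_by G (inv g)"]) simp

lemma conj_class_subset: "k \<in> carrier G \<Longrightarrow> conj_class G k \<subseteq> carrier G"
  by (auto simp: conj_class_def)

lemma conj_class_self: "k \<in> carrier G \<Longrightarrow> k \<in> conj_class G k"
  unfolding conj_class_def by (rule image_eqI[of _ _ \<one>]) auto

lemma conj_class_conj_by:
  assumes "g \<in> carrier G" "k \<in> carrier G"
  shows "conj_class G (conj_by G g k) = conj_class G k"
proof
  show "conj_class G (conj_by G g k) \<subseteq> conj_class G k"
    using assms by (auto simp: conj_class_def simp flip: conj_by_mult)
  have "conj_by G h k = conj_by G (h \<otimes> inv g) (conj_by G g k)" if "h \<in> carrier G" for h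
    using that assms by (simp add: conj_by_mult)
  then show "conj_class G k \<subseteq> conj_class G (conj_by G g k)"
    using assms unfolding conj_class_def by (metis (no_types, lifting) image_subsetI imageI inv_closed m_closed)
qed

lemma conj_class_eq:
  assumes "k \<in> carrier G" "h \<in> conj_class G k"
  shows "conj_class G h = conj_class G k"
proof -
  obtain g where "g \<in> carrier G" "h = conj_by G g k" using assms(2) by (auto simp: conj_class_def)
  then show ?thesis using conj_class_conj_by assms(1) by simp
qed

lemma sk_simps [simp]:
  "verts (sk G X) = carrier G" "arcs (sk G X) = carrier G \<times> (X \<union> m_inv G ` X)"
  "tail (sk G X) (g, y) = g" "head (sk G X) (g, y) = conj_by G y g"
  by (simp_all add: sk_def conj_by_def)

text \<open>A path of length at most \<open>n\<close> multiplies up to a word of length at most \<open>n\<close> in the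
  generators, and there are only finitely many such words.\<close>

lemma finite_conjugators_of_length:
  assumes X: "finite X" "X \<subseteq> carrier G"
  shows "\<exists>W. finite W \<and> W \<subseteq> carrier G \<and>
    (\<forall>g h p. pre_digraph.awalk (sk G X) g p h \<longrightarrow> length p \<le> n \<longrightarrow> (\<exists>w\<in>W. h = conj_by G w g))"
proof -
  interpret W: wf_digraph "sk G X" by (rule sk_wf[OF X(2)])
  show ?thesis
  proof (induction n)
    case 0
    then show ?case by (intro exI[of _ "{\<one>}"]) (auto simp: W.awalk_Nil_iff)
  next
    case (Suc n)
    then obtain W where W: "finite W" "W \<subseteq> carrier G"
      "\<And>g h p. W.awalk g p h \<Longrightarrow> length p \<le> n \<Longrightarrow> \<exists>w\<in>W. h = conj_by G w g" by blast
    define Y where "Y = X \<union> m_inv G ` X"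
    have Y: "finite Y" "Y \<subseteq> carrier G" using X by (auto simp: Y_def)
    define W' where "W' = W \<union> (\<lambda>(w, y). w \<otimes> y) ` (W \<times> Y)"
    have "\<exists>w\<in>W'. h = conj_by G w g" if p: "W.awalk g p h" and len: "length p \<le> Suc n" for g h p
    proof (cases p)
      case Nil
      then obtain w where "w \<in> W" "h = conj_by G w g" using W(3)[OF p] by auto
      then show ?thesis unfolding W'_def by blast
    next
      case (Cons e es)
      obtain y where e: "e = (g, y)" "g \<in> carrier G" "y \<in> Y"
        using p by (cases e) (auto simp: Cons W.awalk_Cons_iff Y_def)
      have "W.awalk (conj_by G y g) es h"
        using p by (simp add: Cons W.awalk_Cons_iff e)
      moreover have "length es \<le> n" using len Cons by simp
      ultimately obtain w where "w \<in> W" "h = conj_by G w (conj_by G y g)" using W(3) by blast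
      moreover have "w \<in> carrier G" "y \<in> carrier G" using calculation(1) e(3) W(2) Y(2) by auto
      ultimately have "w \<otimes> y \<in> W'" "h = conj_by G (w \<otimes> y) g"
        using e by (auto simp: W'_def conj_by_mult)
      then show ?thesis by blast
    qed
    moreover have "finite W'" "W' \<subseteq> carrier G" using W Y by (auto simp: W'_def)
    ultimately show ?case by blast
  qed
qed

lemma finite_conjugators_of_bounded_distance:
  assumes X: "finite X" "X \<subseteq> carrier G"
  shows "\<exists>W. finite W \<and> W \<subseteq> carrier G \<and>
    (\<forall>g h. rho G X g h \<le> ereal N \<longrightarrow> (\<exists>w\<in>W. h = conj_by G w g))"
proof -
  interpret W: wf_digraph "sk G X" by (rule sk_wf[OF X(2)])
  define n where "n = nat \<lceil>N\<rceil> + 1"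
  obtain W where W: "finite W" "W \<subseteq> carrier G"
    "\<And>g h p. W.awalk g p h \<Longrightarrow> length p \<le> n \<Longrightarrow> \<exists>w\<in>W. h = conj_by G w g"
    using finite_conjugators_of_length[OF X] by meson
  have "\<exists>w\<in>W. h = conj_by G w g" if "rho G X g h \<le> ereal N" for g h
  proof -
    have "rho G X g h < ereal (N + 1)" using that by (rule order_le_less_trans) simp
    then obtain p where p: "W.awalk g p h" "W.awalk_cost (\<lambda>_. 1) p < N + 1"
      unfolding rho_def W.\<mu>_def INF_less_iff by auto
    have "W.awalk_cost (\<lambda>_. 1) p = real (length p)"
      by (induction p) auto
    then have "length p \<le> n" using p(2) unfolding n_def by linarith
    then show ?thesis using W(3) p(1) by blast
  qed
  then show ?thesis using W by blast
qed

lemma rho_neighbours: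
  assumes X: "X \<subseteq> carrier G" and g: "g \<in> carrier G" and y: "y \<in> X \<union> m_inv G ` X"
    and ne: "conj_by G y g \<noteq> g"
  shows "rho G X g (conj_by G y g) = 1"
proof (rule antisym)
  interpret W: wf_digraph "sk G X" by (rule sk_wf[OF X])
  have yc: "y \<in> carrier G" using y X by auto
  have "W.awalk g [(g, y)] (conj_by G y g)"
    using g y yc by (simp add: W.awalk_Cons_iff W.awalk_Nil_iff)
  from W.min_cost_le_walk_cost[OF this, of "\<lambda>_. 1"]
  show "rho G X g (conj_by G y g) \<le> 1" by (simp add: rho_def one_ereal_def)
  have "1 \<le> W.awalk_cost (\<lambda>_. 1) p" if "W.awalk g p (conj_by G y g)" for p
  proof (cases p)
    case Nil
    then show ?thesis using that ne by (simp add: W.awalk_Nil_iff)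
  next
    case (Cons e es)
    have "W.awalk_cost (\<lambda>_. 1) es = real (length es)" by (induction es) auto
    then show ?thesis by (simp add: Cons)
  qed
  then show "1 \<le> rho G X g (conj_by G y g)"
    unfolding rho_def W.\<mu>_def by (intro INF_greatest) (simp add: one_ereal_def)
qed

text \<open>The defining property of a BC-group concerns neighbours. Composing conjugators along a path
  from \<open>r\<close> to \<open>k\<close> extends it to any two conjugate elements, and \<open>\<rho>\<close> can then be forgotten.\<close>

definition conjugates_stay_close :: "bool" where
  "conjugates_stay_close \<longleftrightarrow> (\<forall>r\<in>carrier G. \<forall>k\<in>conj_class G r.
     \<exists>W. finite W \<and> W \<subseteq> carrier G \<and>
       (\<forall>g\<in>carrier G. \<exists>w\<in>W. conj_by G g k = conj_by G w (conj_by G g r)))"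

lemma bc_group_conjugates_stay_close:
  assumes X: "finite X" "X \<subseteq> carrier G" and gen: "generate G X = carrier G"
    and bc: "bc_group G X"
  shows conjugates_stay_close
  unfolding conjugates_stay_close_def
proof (intro ballI)
  interpret W: wf_digraph "sk G X" by (rule sk_wf[OF X(2)])
  fix r k assume r: "r \<in> carrier G" and "k \<in> conj_class G r"
  then have "r \<rightarrow>\<^sup>*\<^bsub>sk G X\<^esub> k"
    unfolding sk_reachable[OF X(2) gen] by (auto simp: conj_class_def conj_by_def)
  then show "\<exists>W. finite W \<and> W \<subseteq> carrier G \<and>
      (\<forall>g\<in>carrier G. \<exists>w\<in>W. conj_by G g k = conj_by G w (conj_by G g r))"
  proof (induction rule: W.reachable_induct)
    case base
    then show ?case using r by (intro exI[of _ "{\<one>}"]) auto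
  next
    case (step h k)
    obtain W where W: "finite W" "W \<subseteq> carrier G"
      "\<And>g. g \<in> carrier G \<Longrightarrow> \<exists>w\<in>W. conj_by G g h = conj_by G w (conj_by G g r)"
      using step(3) by blast
    obtain y where h: "h \<in> carrier G" and y: "y \<in> X \<union> m_inv G ` X" and k: "k = conj_by G y h"
      using step(2) unfolding sk_dominates[OF X(2)] conj_by_def by blast
    show ?case
    proof (cases "k = h")
      case True
      then show ?thesis using step(3) by simp
    next
      case False
      have kc: "k \<in> carrier G" using k h y X by auto
      have "rho G X h k = 1" using rho_neighbours[OF X(2) h y] False k by simp
      then obtain C where C: "\<And>g. g \<in> carrier G \<Longrightarrow> rho G X (conj_by G g h) (conj_by G g k) < ereal C"
        using bc h kc unfolding bc_group_def conj_by_def by metis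
      obtain V where V: "finite V" "V \<subseteq> carrier G"
        "\<And>g h. rho G X g h \<le> ereal C \<Longrightarrow> \<exists>v\<in>V. h = conj_by G v g"
        using finite_conjugators_of_bounded_distance[OF X] by meson
      show ?thesis
      proof (intro exI[of _ "(\<lambda>(v, w). v \<otimes> w) ` (V \<times> W)"] conjI ballI)
        fix g assume g: "g \<in> carrier G"
        obtain w where w: "w \<in> W" "conj_by G g h = conj_by G w (conj_by G g r)"
          using W(3)[OF g] by blast
        obtain v where v: "v \<in> V" "conj_by G g k = conj_by G v (conj_by G g h)"
          using V(3) C[OF g] by (meson less_imp_le)
        show "\<exists>u\<in>(\<lambda>(v, w). v \<otimes> w) ` (V \<times> W). conj_by G g k = conj_by G u (conj_by G g r)"
          using v w V(2) W(2) g r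
          by (intro bexI[of _ "v \<otimes> w"]) (auto simp: conj_by_mult subset_iff)
      qed (use V W in auto)
    qed
  qed
qed

text \<open>The uniform bound on diameters becomes one finite set of conjugators for all finite classes.\<close>

lemma uniformly_bounded_finite_classes:
  assumes X: "finite X" "X \<subseteq> carrier G" and gen: "generate G X = carrier G"
    and ub: "uniformly_bounded_finite_components G X"
  shows "\<exists>W. finite W \<and> W \<subseteq> carrier G \<and> (\<forall>k\<in>carrier G. finite (conj_class G k) \<longrightarrow>
    (\<forall>h\<in>conj_class G k. \<exists>w\<in>W. h = conj_by G w k))"
proof -
  obtain N :: real where N: "\<And>K. K \<in> pre_digraph.sccs_verts (sk G X) \<Longrightarrow> finite K \<Longrightarrow>
      rho_diameter G X K \<le> ereal N"
    using ub unfolding uniformly_bounded_finite_components_def by blast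
  obtain W where W: "finite W" "W \<subseteq> carrier G"
    "\<And>g h. rho G X g h \<le> ereal N \<Longrightarrow> \<exists>w\<in>W. h = conj_by G w g"
    using finite_conjugators_of_bounded_distance[OF X] by meson
  have "\<exists>w\<in>W. h = conj_by G w k"
    if k: "k \<in> carrier G" and fin: "finite (conj_class G k)" and h: "h \<in> conj_class G k" for k h
  proof (rule W(3))
    have "conj_class G k \<in> pre_digraph.sccs_verts (sk G X)"
      unfolding sk_components[OF X(2) gen] using k
      by (intro image_eqI[of _ _ k]) (auto simp: conj_class_def conj_by_def)
    then have "rho_diameter G X (conj_class G k) \<le> ereal N" using N fin by blast
    moreover have "rho G X k h \<le> rho_diameter G X (conj_class G k)"
      unfolding rho_diameter_def by (intro SUP_upper2[OF conj_class_self[OF k]] SUP_upper h)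
    ultimately show "rho G X k h \<le> ereal N" by (rule order_trans[rotated])
  qed
  then show ?thesis using W by blast
qed

section \<open>Escaping from finite sets\<close>

text \<open>This is B. H. Neumann's lemma on coverings by cosets, for stabilizers. If an element \<open>g\<close>
  brings all points but \<open>k\<close> outside a given finite set, then \<open>g\<close> sends \<open>k\<close> either outside \<open>E\<close> or to
  one of finitely many \<open>e \<in> E\<close>; in the second case, follow \<open>g\<close> by some \<open>t e\<close> that moves \<open>e\<close>
  outside \<open>E\<close>. It suffices that \<open>g\<close> took the other points outside the finitely many translates
  of \<open>E\<close> under the inverses of the \<open>t e\<close>.\<close>

lemma conjugate_off_finite_set:
  assumes "finite F" "F \<subseteq> carrier G" "\<And>k. k \<in> F \<Longrightarrow> infinite (conj_class G k)"
    and "finite E" "E \<subseteq> carrier G"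
  shows "\<exists>g\<in>carrier G. \<forall>k\<in>F. conj_by G g k \<notin> E"
  using assms
proof (induction F arbitrary: E rule: finite_induct)
  case empty
  then show ?case by (intro bexI[of _ \<one>]) auto
next
  case (insert k F)
  have k: "k \<in> carrier G" and inf: "infinite (conj_class G k)" using insert.prems by auto
  have "\<exists>t\<in>carrier G. conj_by G t e \<notin> E" if e: "e \<in> conj_class G k" for e
  proof -
    have "infinite (conj_class G e)" using inf conj_class_eq[OF k e] by simp
    then have "\<not> conj_class G e \<subseteq> E" using insert.prems(3) finite_subset by blast
    then show ?thesis by (auto simp: conj_class_def)
  qed
  then obtain t where t: "\<And>e. e \<in> conj_class G k \<Longrightarrow> t e \<in> carrier G"
      "\<And>e. e \<in> conj_class G k \<Longrightarrow> conj_by G (t e) e \<notin> E" by metis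
  \<comment> \<open>Only \<open>e \<in> E\<close> can be a bad image of \<open>k\<close>, so finitely many translates of \<open>E\<close> are involved.\<close>
  define E' where "E' = E \<union> (\<Union>e\<in>E \<inter> conj_class G k. conj_by G (inv (t e)) ` E)"
  have "finite E'" "E' \<subseteq> carrier G" using insert.prems t by (auto simp: E'_def)
  moreover have "F \<subseteq> carrier G" "\<And>k. k \<in> F \<Longrightarrow> infinite (conj_class G k)"
    using insert.prems by auto
  ultimately obtain g where g: "g \<in> carrier G" "\<And>j. j \<in> F \<Longrightarrow> conj_by G g j \<notin> E'"
    using insert.IH[of E'] by blast
  show ?case
  proof (cases "conj_by G g k \<in> E")
    case False
    then show ?thesis using g by (intro bexI[of _ g]) (auto simp: E'_def)
  next
    case True
    define e where "e = conj_by G g k"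
    have e: "e \<in> E \<inter> conj_class G k" using True g by (auto simp: e_def conj_class_def)
    then have te: "t e \<in> carrier G" using t by auto
    have "conj_by G (t e) (conj_by G g j) \<notin> E" if j: "j \<in> F" for j
    proof
      have jc: "j \<in> carrier G" using j insert.prems by auto
      assume "conj_by G (t e) (conj_by G g j) \<in> E"
      then have "conj_by G (inv (t e)) (conj_by G (t e) (conj_by G g j)) \<in> E'"
        using e unfolding E'_def by blast
      then show False using g j jc te by simp
    qed
    moreover have "conj_by G (t e) (conj_by G g k) \<notin> E" using t(2)[of e] e by (simp add: e_def)
    ultimately show ?thesis
      using g te k insert.prems(1) by (intro bexI[of _ "t e \<otimes> g"]) (auto simp: conj_by_mult subset_iff)
  qed
qed

end

section \<open>Bounded cocycles for the conjugation action\<close>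

text \<open>The bound concerns the \<open>q\<close>-th power of the norm, and is stated for finite sums so that it
  includes the summability of every \<open>\<phi> g\<close>.\<close>

locale bounded_conj_cocycle = group G for G (structure) +
  fixes q B :: real and \<phi> :: "'a \<Rightarrow> 'a \<Rightarrow> complex"
  assumes exponent: "1 \<le> q"
    and cocycle: "\<And>g h k. g \<in> carrier G \<Longrightarrow> h \<in> carrier G \<Longrightarrow> k \<in> carrier G \<Longrightarrow>
      \<phi> (g \<otimes> h) k = \<phi> g k + \<phi> h (conj_by G (inv g) k)"
    and bounded: "\<And>g F. g \<in> carrier G \<Longrightarrow> finite F \<Longrightarrow> F \<subseteq> carrier G \<Longrightarrow>
      (\<Sum>k\<in>F. cmod (\<phi> g k) powr q) \<le> B"
begin

lemma bound_nonneg: "0 \<le> B"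
  using bounded[of \<one> "{}"] by simp

lemma cocycle_le:
  assumes "g \<in> carrier G" "k \<in> carrier G"
  shows "cmod (\<phi> g k) \<le> B powr (1 / q)"
proof -
  have "cmod (\<phi> g k) powr q \<le> B" using bounded[of g "{k}"] assms by simp
  then have "(cmod (\<phi> g k) powr q) powr (1 / q) \<le> B powr (1 / q)"
    using exponent by (intro powr_mono2) auto
  then show ?thesis using exponent by (simp add: powr_powr)
qed

lemma cocycle_tendsto_0:
  assumes g: "g \<in> carrier G" and e: "inj e" "range e \<subseteq> carrier G"
  shows "(\<lambda>n::nat. \<phi> g (e n)) \<longlonglongrightarrow> 0"
proof -
  have "summable (\<lambda>n. cmod (\<phi> g (e n)) powr q)"
  proof (rule bounded_imp_summable)
    fix n
    have "(\<Sum>i\<le>n. cmod (\<phi> g (e i)) powr q) = (\<Sum>k\<in>e ` {..n}. cmod (\<phi> g k) powr q)"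
      using e by (subst sum.reindex) (auto intro: inj_on_subset)
    also have "\<dots> \<le> B" using g e by (intro bounded) auto
    finally show "(\<Sum>i\<le>n. cmod (\<phi> g (e i)) powr q) \<le> B" .
  qed simp
  then have "(\<lambda>n. cmod (\<phi> g (e n)) powr q) \<longlonglongrightarrow> 0" by (rule summable_LIMSEQ_zero)
  then have "(\<lambda>n. (cmod (\<phi> g (e n)) powr q) powr (1 / q)) \<longlonglongrightarrow> 0 powr (1 / q)"
    using exponent by (intro tendsto_powr2 tendsto_const) auto
  then show ?thesis using exponent by (simp add: powr_powr tendsto_norm_zero_iff)
qed

text \<open>On the stabilizer of \<open>k\<close>, the map \<open>s \<mapsto> \<phi> s k\<close> is a bounded homomorphism into the
  complex numbers, hence zero.\<close>

lemma cocycle_stabilizer: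
  assumes s: "s \<in> carrier G" and k: "k \<in> carrier G" and stab: "conj_by G s k = k"
  shows "\<phi> s k = 0"
proof (rule ccontr)
  have inv: "conj_by G (inv s) k = k" using conj_by_inv(1)[OF s k] stab by simp
  have one: "\<phi> \<one> k = 0" using cocycle[of \<one> \<one> k] k by simp
  have pow: "\<phi> (s [^] n) k = of_nat n * \<phi> s k" for n :: nat
  proof (induction n)
    case (Suc n)
    have "\<phi> (s [^] Suc n) k = \<phi> (s \<otimes> s [^] n) k" unfolding nat_pow_Suc2[OF s] ..
    also have "\<dots> = \<phi> s k + of_nat n * \<phi> s k" using s k Suc by (simp add: cocycle inv)
    finally show ?case by (simp add: algebra_simps)
  qed (simp add: one)
  assume "\<phi> s k \<noteq> 0"
  then obtain n :: nat where "B powr (1 / q) < real n * cmod (\<phi> s k)"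
    using ex_less_of_nat_mult[of "cmod (\<phi> s k)"] by auto
  moreover have "real n * cmod (\<phi> s k) \<le> B powr (1 / q)"
    using cocycle_le[of "s [^] n" k] s k by (simp add: pow norm_mult)
  ultimately show False by simp
qed

text \<open>With \<open>l = conj_by G g k\<close> this reads \<open>\<phi> g l = x l - x (g\<inverse> l g)\<close>: the cocycle is the
  coboundary of \<open>x\<close>.\<close>

definition potential :: "('a \<Rightarrow> complex) \<Rightarrow> bool" where
  "potential x \<longleftrightarrow> (\<forall>g\<in>carrier G. \<forall>k\<in>carrier G.
     \<phi> g (conj_by G g k) = x (conj_by G g k) - x k)"

text \<open>Fix a base point in each class, where \<open>x\<close> is to vanish. The value of \<open>x\<close> at \<open>k\<close> must then be
  \<open>\<phi> t k\<close> for any \<open>t\<close> that conjugates the base point to \<open>k\<close>; the vanishing of \<open>\<phi>\<close> on stabilizers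
  makes this independent of \<open>t\<close>.\<close>

lemma ex_potential: "\<exists>x. potential x"
proof -
  define r where "r K = (SOME k. k \<in> K)" for K :: "'a set"
  have r: "r (conj_class G k) \<in> conj_class G k" if "k \<in> carrier G" for k
    unfolding r_def using conj_class_self[OF that] by (rule someI)
  have "\<exists>t\<in>carrier G. k = conj_by G t (r (conj_class G k))" if k: "k \<in> carrier G" for k
  proof -
    have "k \<in> conj_class G (r (conj_class G k))"
      using conj_class_self[OF k] conj_class_eq[OF k r[OF k]] by simp
    then show ?thesis by (auto simp: conj_class_def)
  qed
  then obtain t where t: "\<And>k. k \<in> carrier G \<Longrightarrow> t k \<in> carrier G"
    "\<And>k. k \<in> carrier G \<Longrightarrow> conj_by G (t k) (r (conj_class G k)) = k" by metis
  have "potential (\<lambda>k. \<phi> (t k) k)"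
    unfolding potential_def
  proof (intro ballI)
    fix g k assume g: "g \<in> carrier G" and k: "k \<in> carrier G"
    define l where "l = conj_by G g k"
    define r0 where "r0 = r (conj_class G k)"
    have l: "l \<in> carrier G" "conj_class G l = conj_class G k"
      using g k conj_class_conj_by by (auto simp: l_def)
    have r0: "r0 \<in> carrier G" using r[OF k] conj_class_subset[OF k] by (auto simp: r0_def)
    have tk: "t k \<in> carrier G" "conj_by G (t k) r0 = k" using t k by (auto simp: r0_def)
    have tl: "t l \<in> carrier G" "conj_by G (t l) r0 = l" using t(1)[OF l(1)] t(2)[OF l(1)] l by (auto simp: r0_def)
    \<comment> \<open>Both \<open>g \<otimes> t k\<close> and \<open>t l\<close> carry the base point to \<open>l\<close>, so they differ by \<open>s\<close> in its stabilizer.\<close>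
    define s where "s = inv (t l) \<otimes> (g \<otimes> t k)"
    have s: "s \<in> carrier G" using tl tk g by (simp add: s_def)
    have "conj_by G s r0 = conj_by G (inv (t l)) l"
      using tl tk g r0 by (simp add: s_def conj_by_mult l_def)
    also have "\<dots> = r0" using conj_by_inv(1)[OF tl(1) r0] tl(2) by simp
    finally have s0: "\<phi> s r0 = 0" by (rule cocycle_stabilizer[OF s r0])
    have "conj_by G (inv (t l)) l = r0" using conj_by_inv(1)[OF tl(1) r0] tl(2) by simp
    then have "\<phi> (t l \<otimes> s) l = \<phi> (t l) l" using cocycle[OF tl(1) s l(1)] s0 by simp
    moreover have "t l \<otimes> s = g \<otimes> t k" using tl tk g by (simp add: s_def flip: m_assoc)
    moreover have "\<phi> (g \<otimes> t k) l = \<phi> g l + \<phi> (t k) k"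
      using cocycle[OF g tk(1) l(1)] g k by (simp add: l_def)
    ultimately show "\<phi> g (conj_by G g k) = \<phi> (t (conj_by G g k)) (conj_by G g k) - \<phi> (t k) k"
      by (simp add: l_def eq_diff_eq)
  qed
  then show ?thesis by (rule exI[of potential])
qed

lemma potential_increments_bounded:
  assumes x: "potential x" and g: "g \<in> carrier G" and F: "finite F" "F \<subseteq> carrier G"
  shows "(\<Sum>k\<in>F. cmod (x (conj_by G g k) - x k) powr q) \<le> B"
proof -
  have inj: "inj_on (conj_by G g) F" using conj_by_inj[OF g] F(2) by (rule inj_on_subset)
  have "(\<Sum>k\<in>F. cmod (x (conj_by G g k) - x k) powr q)
      = (\<Sum>k\<in>conj_by G g ` F. cmod (\<phi> g k) powr q)"
    unfolding sum.reindex[OF inj] o_def using x g F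
    by (intro sum.cong) (auto simp: potential_def subset_iff)
  also have "\<dots> \<le> B" using g F by (intro bounded) auto
  finally show ?thesis .
qed

text \<open>The set \<open>F\<close> being finite, the bound on the increments of \<open>x\<close> along \<open>g n\<close> passes to the limit.\<close>

lemma limit_of_translates_bounded:
  assumes x: "potential x" and g: "\<And>n::nat. g n \<in> carrier G" and F: "finite F" "F \<subseteq> carrier G"
    and lim: "\<And>k. k \<in> F \<Longrightarrow> (\<lambda>n. x (conj_by G (g n) k)) \<longlonglongrightarrow> c"
  shows "(\<Sum>k\<in>F. cmod (x k - c) powr q) \<le> B"
proof -
  have "(\<lambda>n. \<Sum>k\<in>F. cmod (x (conj_by G (g n) k) - x k) powr q)
      \<longlonglongrightarrow> (\<Sum>k\<in>F. cmod (c - x k) powr q)"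
    using exponent
    by (intro tendsto_sum tendsto_powr2 tendsto_norm tendsto_diff tendsto_const lim) auto
  then have "(\<Sum>k\<in>F. cmod (c - x k) powr q) \<le> B"
    by (rule LIMSEQ_le_const2) (use potential_increments_bounded[OF x g F] in blast)
  then show ?thesis by (simp add: norm_minus_commute)
qed

text \<open>Choose translates \<open>e n\<close> of \<open>r\<close> that run to infinity and along which the bounded function
  \<open>x\<close> converges. The translates of any other \<open>k\<close> by the same group elements arise from the \<open>e n\<close> by
  conjugation with elements of a fixed finite set, so that \<open>x\<close> changes by a value of one of finitely
  many \<open>\<phi> w\<close> at a point running to infinity. Hence the limit \<open>c\<close> is the same for all \<open>k\<close>.\<close>

lemma ex_limit_on_infinite_class:
  assumes x: "potential x" and close: conjugates_stay_close
    and r: "r \<in> carrier G" and inf: "infinite (conj_class G r)"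
  shows "\<exists>c. \<forall>F. finite F \<longrightarrow> F \<subseteq> conj_class G r \<longrightarrow> (\<Sum>k\<in>F. cmod (x k - c) powr q) \<le> B"
proof -
  \<comment> \<open>Some sequence of distinct points of the class runs to infinity; the required one is a subsequence.\<close>
  obtain e0 :: "nat \<Rightarrow> 'a" where e0: "inj e0" "range e0 \<subseteq> conj_class G r"
    using infinite_countable_subset[OF inf] by blast
  have "\<exists>g\<in>carrier G. e0 n = conj_by G g r" for n
    using e0(2) by (auto simp: conj_class_def)
  then obtain g0 where g0: "\<And>n. g0 n \<in> carrier G" "\<And>n. e0 n = conj_by G (g0 n) r" by metis
  have "bounded (range (\<lambda>n. x (e0 n)))"
    unfolding bounded_iff
  proof (intro exI ballI)
    fix z assume "z \<in> range (\<lambda>n. x (e0 n))"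
    then obtain n where z: "z = x (e0 n)" by blast
    have "\<phi> (g0 n) (e0 n) = x (e0 n) - x r"
      using x g0(1)[of n] r unfolding potential_def g0(2) by blast
    then have "z = \<phi> (g0 n) (e0 n) + x r" using z by simp
    also have "cmod \<dots> \<le> B powr (1 / q) + cmod (x r)"
      using cocycle_le[of "g0 n" "e0 n"] g0 r by (intro order_trans[OF norm_triangle_ineq]) auto
    finally show "cmod z \<le> B powr (1 / q) + cmod (x r)" .
  qed
  then obtain c and \<sigma> :: "nat \<Rightarrow> nat" where \<sigma>: "strict_mono \<sigma>" "(\<lambda>n. x (e0 (\<sigma> n))) \<longlonglongrightarrow> c"
    using bounded_imp_convergent_subsequence[of "\<lambda>n. x (e0 n)"] by (auto simp: o_def)
  define e g where "e = e0 \<circ> \<sigma>" and "g = g0 \<circ> \<sigma>"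
  have e: "inj e" unfolding e_def using e0(1) \<sigma>(1) by (intro inj_compose strict_mono_imp_inj_on)
  have g: "g n \<in> carrier G" and eg: "e n = conj_by G (g n) r" for n
    using g0 by (auto simp: e_def g_def)
  have ec: "e n \<in> carrier G" for n using eg g r by simp
  have lim: "(\<lambda>n. x (conj_by G (g n) k)) \<longlonglongrightarrow> c" if k: "k \<in> conj_class G r" for k
  proof -
    obtain W where W: "finite W" "W \<subseteq> carrier G"
      "\<And>g. g \<in> carrier G \<Longrightarrow> \<exists>w\<in>W. conj_by G g k = conj_by G w (conj_by G g r)"
      using close r k unfolding conjugates_stay_close_def by meson
    have "(\<lambda>n. \<Sum>w\<in>W. cmod (\<phi> w (conj_by G w (e n)))) \<longlonglongrightarrow> (\<Sum>w\<in>W. 0)"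
    proof (intro tendsto_sum tendsto_norm_zero)
      fix w assume w: "w \<in> W"
      have "inj_on (conj_by G w) (range e)"
        using conj_by_inj[of w] w W(2) ec by (auto intro: inj_on_subset)
      then have "inj (\<lambda>n. conj_by G w (e n))"
        using comp_inj_on[OF e] by (simp add: o_def)
      then show "(\<lambda>n. \<phi> w (conj_by G w (e n))) \<longlonglongrightarrow> 0"
        using w W(2) ec by (intro cocycle_tendsto_0) auto
    qed
    then have null: "(\<lambda>n. \<Sum>w\<in>W. cmod (\<phi> w (conj_by G w (e n)))) \<longlonglongrightarrow> 0" by simp
    have "cmod (x (conj_by G (g n) k) - x (e n)) \<le> (\<Sum>w\<in>W. cmod (\<phi> w (conj_by G w (e n))))" for n
    proof -
      obtain w where w: "w \<in> W" "conj_by G (g n) k = conj_by G w (e n)"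
        using W(3)[OF g[of n]] eg by metis
      then have "x (conj_by G (g n) k) - x (e n) = \<phi> w (conj_by G w (e n))"
        using x W(2) ec[of n] unfolding potential_def by (metis subsetD)
      then show ?thesis
        using member_le_sum[OF w(1) _ W(1), of "\<lambda>w. cmod (\<phi> w (conj_by G w (e n)))"] by simp
    qed
    then have "(\<lambda>n. x (conj_by G (g n) k) - x (e n)) \<longlonglongrightarrow> 0"
      by (intro Lim_null_comparison[OF always_eventually null] allI)
    from tendsto_add[OF this \<sigma>(2)[folded o_def, unfolded comp_assoc]] show ?thesis
      by (simp add: e_def)
  qed
  have "(\<Sum>k\<in>F. cmod (x k - c) powr q) \<le> B" if "finite F" "F \<subseteq> conj_class G r" for F
    using that conj_class_subset[OF r] lim
    by (intro limit_of_translates_bounded[where g = g] x g) auto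
  then show ?thesis by blast
qed

lemma finite_level_set:
  assumes sums: "\<And>F. finite F \<Longrightarrow> F \<subseteq> K \<Longrightarrow> (\<Sum>k\<in>F. cmod (y k) powr q) \<le> B" and \<epsilon>: "0 < \<epsilon>"
  shows "finite {k \<in> K. \<epsilon> \<le> cmod (y k)}"
proof (rule ccontr)
  obtain n :: nat where n: "B < real n * \<epsilon> powr q"
    using ex_less_of_nat_mult[of "\<epsilon> powr q" B] \<epsilon> by auto
  assume "infinite {k \<in> K. \<epsilon> \<le> cmod (y k)}"
  then obtain F where F: "finite F" "card F = n" "F \<subseteq> {k \<in> K. \<epsilon> \<le> cmod (y k)}"
    using infinite_arbitrarily_large by blast
  have "real n * \<epsilon> powr q \<le> (\<Sum>k\<in>F. cmod (y k) powr q)"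
    unfolding F(2)[symmetric] using F \<epsilon> exponent
    by (intro sum_bounded_below powr_mono2) auto
  also have "\<dots> \<le> B" using F by (intro sums) auto
  finally show False using n by simp
qed

text \<open>Adding up the bounds for the single classes would give nothing, since there may be infinitely
  many classes. Instead, a finite set \<open>F\<close> that meets several classes is pushed to infinity as a whole:
  along group elements bringing all points of \<open>F\<close> to where \<open>y\<close> is small, the increments of \<open>y\<close>
  converge to \<open>-y\<close> on \<open>F\<close>.\<close>

lemma infinite_classes_bound:
  assumes y: "potential y"
    and sums: "\<And>r F. r \<in> carrier G \<Longrightarrow> infinite (conj_class G r) \<Longrightarrow> finite F \<Longrightarrow>
      F \<subseteq> conj_class G r \<Longrightarrow> (\<Sum>k\<in>F. cmod (y k) powr q) \<le> B"
    and F: "finite F" "F \<subseteq> carrier G" and inf: "\<And>k. k \<in> F \<Longrightarrow> infinite (conj_class G k)"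
  shows "(\<Sum>k\<in>F. cmod (y k) powr q) \<le> B"
proof -
  have "\<exists>g\<in>carrier G. \<forall>k\<in>F. cmod (y (conj_by G g k)) < inverse (Suc n)" for n :: nat
  proof -
    define E where "E = (\<Union>k\<in>F. {h \<in> conj_class G k. inverse (Suc n) \<le> cmod (y h)})"
    have E: "finite E" unfolding E_def
      using F inf by (intro finite_UN_I finite_level_set sums) auto
    have "E \<subseteq> carrier G" using F conj_class_subset by (auto simp: E_def subset_iff)
    from conjugate_off_finite_set[OF F inf E this]
    obtain g where g: "g \<in> carrier G" "\<And>k. k \<in> F \<Longrightarrow> conj_by G g k \<notin> E" by blast
    have "cmod (y (conj_by G g k)) < inverse (Suc n)" if "k \<in> F" for k
    proof -
      have "conj_by G g k \<in> conj_class G k" using g(1) by (auto simp: conj_class_def)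
      then show ?thesis using g(2)[OF that] that unfolding E_def by force
    qed
    then show ?thesis using g by blast
  qed
  then obtain g where g: "\<And>n. g n \<in> carrier G"
    "\<And>n k. k \<in> F \<Longrightarrow> cmod (y (conj_by G (g n) k)) < inverse (Suc n)" by metis
  have "(\<Sum>k\<in>F. cmod (y k - 0) powr q) \<le> B"
  proof (rule limit_of_translates_bounded[OF y g(1) F])
    fix k assume "k \<in> F"
    then have "cmod (y (conj_by G (g n) k)) \<le> inverse (real (Suc n))" for n
      by (intro less_imp_le g(2))
    then show "(\<lambda>n. y (conj_by G (g n) k)) \<longlonglongrightarrow> 0"
      by (intro Lim_null_comparison[OF always_eventually LIMSEQ_inverse_real_of_nat] allI)
  qed
  then show ?thesis by simp
qed

text \<open>If \<open>y\<close> vanishes at \<open>conj_by G w k\<close>, then \<open>y k\<close> is, up to sign, the increment of \<open>y\<close> from \<open>k\<close>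
  under \<open>w\<close>; summing over the finitely many \<open>w\<close> covers all points.\<close>

lemma finite_classes_bound:
  assumes y: "potential y" and W: "finite W" "W \<subseteq> carrier G"
    and F: "finite F" "F \<subseteq> carrier G"
    and zero: "\<And>k. k \<in> F \<Longrightarrow> \<exists>w\<in>W. y (conj_by G w k) = 0"
  shows "(\<Sum>k\<in>F. cmod (y k) powr q) \<le> real (card W) * B"
proof -
  have "(\<Sum>k\<in>F. cmod (y k) powr q) \<le> (\<Sum>k\<in>F. \<Sum>w\<in>W. cmod (y (conj_by G w k) - y k) powr q)"
  proof (rule sum_mono)
    fix k assume "k \<in> F"
    then obtain w where w: "w \<in> W" "y (conj_by G w k) = 0" using zero by blast
    then have "cmod (y k) powr q = cmod (y (conj_by G w k) - y k) powr q" by simp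
    also have "\<dots> \<le> (\<Sum>w\<in>W. cmod (y (conj_by G w k) - y k) powr q)"
      using w(1) W(1) by (intro member_le_sum[of w W "\<lambda>w. cmod (y (conj_by G w k) - y k) powr q"]) auto
    finally show "cmod (y k) powr q \<le> (\<Sum>w\<in>W. cmod (y (conj_by G w k) - y k) powr q)" .
  qed
  also have "\<dots> = (\<Sum>w\<in>W. \<Sum>k\<in>F. cmod (y (conj_by G w k) - y k) powr q)" by (rule sum.swap)
  also have "\<dots> \<le> (\<Sum>w\<in>W. B)"
    using W F by (intro sum_mono potential_increments_bounded[OF y]) auto
  finally show ?thesis by simp
qed

lemma ex_summable_potential:
  assumes close: conjugates_stay_close
    and W: "finite W" "W \<subseteq> carrier G"
      "\<And>k h. k \<in> carrier G \<Longrightarrow> finite (conj_class G k) \<Longrightarrow> h \<in> conj_class G k \<Longrightarrow>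
        \<exists>w\<in>W. h = conj_by G w k"
  shows "\<exists>y. potential y \<and> (\<forall>F. finite F \<longrightarrow> F \<subseteq> carrier G \<longrightarrow>
    (\<Sum>k\<in>F. cmod (y k) powr q) \<le> (real (card W) + 1) * B)"
proof -
  obtain x where x: "potential x" using ex_potential by blast
  \<comment> \<open>A potential may be shifted by a constant on each class: by its limit at infinity on an infinite
    class, and by its value at some point on a finite one.\<close>
  have "\<forall>K\<in>conj_class G ` carrier G. \<exists>c.
      (infinite K \<longrightarrow> (\<forall>F. finite F \<longrightarrow> F \<subseteq> K \<longrightarrow> (\<Sum>k\<in>F. cmod (x k - c) powr q) \<le> B)) \<and>
      (finite K \<longrightarrow> (\<exists>h\<in>K. x h = c))"
  proof
    fix K assume "K \<in> conj_class G ` carrier G"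
    then obtain r where r: "r \<in> carrier G" "K = conj_class G r" by blast
    show "\<exists>c. (infinite K \<longrightarrow> (\<forall>F. finite F \<longrightarrow> F \<subseteq> K \<longrightarrow> (\<Sum>k\<in>F. cmod (x k - c) powr q) \<le> B)) \<and>
      (finite K \<longrightarrow> (\<exists>h\<in>K. x h = c))"
    proof (cases "finite K")
      case True
      then show ?thesis using r conj_class_self[OF r(1)] by auto
    next
      case False
      then show ?thesis using ex_limit_on_infinite_class[OF x close r(1)] r(2) by auto
    qed
  qed
  then obtain c where "\<forall>K\<in>conj_class G ` carrier G.
      (infinite K \<longrightarrow> (\<forall>F. finite F \<longrightarrow> F \<subseteq> K \<longrightarrow> (\<Sum>k\<in>F. cmod (x k - c K) powr q) \<le> B)) \<and>
      (finite K \<longrightarrow> (\<exists>h\<in>K. x h = c K))"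
    by (rule bchoice[THEN exE])
  then have c_inf: "\<And>r F. r \<in> carrier G \<Longrightarrow> infinite (conj_class G r) \<Longrightarrow> finite F \<Longrightarrow>
      F \<subseteq> conj_class G r \<Longrightarrow> (\<Sum>k\<in>F. cmod (x k - c (conj_class G r)) powr q) \<le> B"
    and c_fin: "\<And>r. r \<in> carrier G \<Longrightarrow> finite (conj_class G r) \<Longrightarrow>
      \<exists>h\<in>conj_class G r. x h = c (conj_class G r)" by blast+
  define y where "y k = x k - c (conj_class G k)" for k
  have y: "potential y"
    using x by (simp add: potential_def y_def conj_class_conj_by)
  have y_inf: "(\<Sum>k\<in>F. cmod (y k) powr q) \<le> B"
    if "r \<in> carrier G" "infinite (conj_class G r)" "finite F" "F \<subseteq> conj_class G r" for r F
  proof -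
    have "(\<Sum>k\<in>F. cmod (y k) powr q) = (\<Sum>k\<in>F. cmod (x k - c (conj_class G r)) powr q)"
      using that conj_class_eq[OF that(1)] by (intro sum.cong) (auto simp: y_def subset_iff)
    then show ?thesis using c_inf[OF that] by simp
  qed
  have y_fin: "\<exists>w\<in>W. y (conj_by G w k) = 0"
    if k: "k \<in> carrier G" and fin: "finite (conj_class G k)" for k
  proof -
    obtain h where h: "h \<in> conj_class G k" "x h = c (conj_class G k)" using c_fin[OF k fin] by blast
    then have "y h = 0" using conj_class_eq[OF k h(1)] by (simp add: y_def)
    then show ?thesis using W(3)[OF k fin h(1)] by auto
  qed
  have "(\<Sum>k\<in>F. cmod (y k) powr q) \<le> (real (card W) + 1) * B"
    if F: "finite F" "F \<subseteq> carrier G" for F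
  proof -
    define F1 where "F1 = {k \<in> F. finite (conj_class G k)}"
    have "(\<Sum>k\<in>F. cmod (y k) powr q)
        = (\<Sum>k\<in>F1. cmod (y k) powr q) + (\<Sum>k\<in>F - F1. cmod (y k) powr q)"
      using F by (subst sum.subset_diff[of F1]) (auto simp: F1_def)
    also have "\<dots> \<le> real (card W) * B + B"
    proof (rule add_mono)
      show "(\<Sum>k\<in>F1. cmod (y k) powr q) \<le> real (card W) * B"
        using F y_fin by (intro finite_classes_bound[OF y W(1,2)]) (auto simp: F1_def)
      show "(\<Sum>k\<in>F - F1. cmod (y k) powr q) \<le> B"
        using F by (intro infinite_classes_bound[OF y y_inf]) (auto simp: F1_def)
    qed
    finally show ?thesis by (simp add: algebra_simps)
  qed
  then show ?thesis using y by blast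
qed

end

section \<open>Derivations and cocycles\<close>

context group
begin

lemma delta_in_group_ring: "g \<in> carrier G \<Longrightarrow> delta g \<in> group_ring G"
  by (auto simp: group_ring_def delta_def)

text \<open>Evaluating the Leibniz rule \<open>d(gh) = d(g)h + g d(h)\<close> at \<open>kgh\<close> gives the cocycle identity for
  \<open>\<phi> g k = d(g)(kg)\<close>, which is the value of \<open>d(g) g\<inverse>\<close> at \<open>k\<close>.\<close>

lemma derivation_cocycle:
  assumes der: "derivation G (fp G p) (ell G q) d"
    and g: "g \<in> carrier G" and h: "h \<in> carrier G" and k: "k \<in> carrier G"
  shows "d (delta (g \<otimes> h)) (k \<otimes> (g \<otimes> h)) =
    d (delta g) (k \<otimes> g) + d (delta h) (conj_by G (inv g) k \<otimes> h)"
proof -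
  have "d (gr_mult G (delta g) (delta h)) =
      (\<lambda>k. ract G (d (delta g)) (delta h) k + lact G (delta g) (d (delta h)) k)"
    using der delta_in_group_ring[OF g] delta_in_group_ring[OF h]
    by (simp add: derivation_def fp_def)
  then have "d (delta (g \<otimes> h)) (k \<otimes> (g \<otimes> h)) =
      d (delta g) (k \<otimes> (g \<otimes> h) \<otimes> inv h) + d (delta h) (inv g \<otimes> (k \<otimes> (g \<otimes> h)))"
    using g h k by (simp add: gr_mult_delta ract_delta lact_delta)
  moreover have "k \<otimes> (g \<otimes> h) \<otimes> inv h = k \<otimes> g" using g h k by (simp add: m_assoc)
  moreover have "inv g \<otimes> (k \<otimes> (g \<otimes> h)) = conj_by G (inv g) k \<otimes> h"
    using g h k by (simp add: conj_by_def m_assoc)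
  ultimately show ?thesis by simp
qed

lemma bounded_derivation_cocycle:
  assumes q: "1 \<le> q" and der: "derivation G (fp G p) (ell G q) d"
    and bdd: "G_bounded G (ell G q) d"
  shows "\<exists>B. bounded_conj_cocycle G q B (\<lambda>g k. d (delta g) (k \<otimes> g))"
proof -
  obtain M where M: "\<And>g. g \<in> carrier G \<Longrightarrow> lp_norm G q (d (delta g)) \<le> M"
    using bdd by (auto simp: G_bounded_def ell_def bdd_above_def)
  have "bounded_conj_cocycle G q (M powr q) (\<lambda>g k. d (delta g) (k \<otimes> g))"
  proof (intro bounded_conj_cocycle.intro bounded_conj_cocycle_axioms.intro)
    fix g F assume g: "g \<in> carrier G" and F: "finite F" "F \<subseteq> carrier G"
    have "d (delta g) \<in> vecs (ell G q)"
      using der delta_in_group_ring[OF g] by (simp add: derivation_def fp_def)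
    moreover have inj: "inj_on (\<lambda>k. k \<otimes> g) F"
      using F g by (auto simp: inj_on_def subset_iff)
    ultimately have "(\<Sum>k\<in>(\<lambda>k. k \<otimes> g) ` F. cmod (d (delta g) k) powr q)
        \<le> lp_norm G q (d (delta g)) powr q"
      using F g q by (intro sum_le_lp_norm) auto
    also have "\<dots> \<le> M powr q" using M[OF g] q by (intro powr_mono2) (auto simp: lp_norm_nonneg)
    finally show "(\<Sum>k\<in>F. cmod (d (delta g) (k \<otimes> g)) powr q) \<le> M powr q"
      by (simp add: sum.reindex[OF inj])
  qed (use derivation_cocycle[OF der] q in \<open>auto simp: group_axioms\<close>)
  then show ?thesis ..
qed

lemma linear_eq_on_group_ring:
  assumes add: "\<And>a b. a \<in> group_ring G \<Longrightarrow> b \<in> group_ring G \<Longrightarrow>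
      d (\<lambda>k. a k + b k) = (\<lambda>k. d a k + d b k)"
    and scale: "\<And>c a. a \<in> group_ring G \<Longrightarrow> d (\<lambda>k. c * a k) = (\<lambda>k. c * d a k)"
    and a: "a \<in> group_ring G"
  shows "d a k = (\<Sum>g | a g \<noteq> 0. a g * d (delta g) k)"
proof -
  have "finite S \<Longrightarrow> S \<subseteq> carrier G \<Longrightarrow>
      (\<lambda>h. if h \<in> S then a h else 0) \<in> group_ring G \<and>
      d (\<lambda>h. if h \<in> S then a h else 0) k = (\<Sum>g\<in>S. a g * d (delta g) k)" for S
  proof (induction S rule: finite_induct)
    case empty
    have "(\<lambda>h. 0) \<in> group_ring G" by (simp add: group_ring_def)
    then show ?case using scale[of "\<lambda>h. 0" 0] by (auto dest: fun_cong)
  next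
    case (insert g S)
    then have g: "g \<in> carrier G" and S: "(\<lambda>h. if h \<in> S then a h else 0) \<in> group_ring G"
      "d (\<lambda>h. if h \<in> S then a h else 0) k = (\<Sum>g\<in>S. a g * d (delta g) k)" by auto
    have dg: "(\<lambda>h. a g * delta g h) \<in> group_ring G"
      using g by (auto simp: group_ring_def delta_def)
    have eq: "(\<lambda>h. if h \<in> insert g S then a h else 0) =
        (\<lambda>h. a g * delta g h + (if h \<in> S then a h else 0))"
      using insert.hyps by (auto simp: delta_def fun_eq_iff)
    have "(\<lambda>h. if h \<in> insert g S then a h else 0) \<in> group_ring G"
      using insert.hyps insert.prems by (auto simp: group_ring_def)
    moreover have "d (\<lambda>h. if h \<in> insert g S then a h else 0) k =
        a g * d (delta g) k + (\<Sum>g\<in>S. a g * d (delta g) k)"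
      unfolding eq add[OF dg S(1)] scale[OF delta_in_group_ring[OF g]] S(2) ..
    ultimately show ?case using insert.hyps by simp
  qed
  from this[of "{g. a g \<noteq> 0}"] a
  have "d (\<lambda>h. if h \<in> {g. a g \<noteq> 0} then a h else 0) k = (\<Sum>g | a g \<noteq> 0. a g * d (delta g) k)"
    by (simp add: group_ring_def)
  moreover have "(\<lambda>h. if h \<in> {g. a g \<noteq> 0} then a h else 0) = a" by auto
  ultimately show ?thesis by simp
qed

end

theorem theorem2:
  fixes G (structure) and X :: "'a set" and p q :: real
    and d :: "('a \<Rightarrow> complex) \<Rightarrow> 'a \<Rightarrow> complex"
  assumes "group G"
    and "finite X" "X \<subseteq> carrier G" "generate G X = carrier G"
    and "bc_group G X"
    and "uniformly_bounded_finite_components G X"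
    and "1 \<le> p" "1 \<le> q"
    and "derivation G (fp G p) (ell G q) d"
    and "G_bounded G (ell G q) d"
  shows "\<exists>x\<in>vecs (ell G q). \<forall>a\<in>group_ring G. d a = (\<lambda>k. ract G x a k - lact G a x k)"
proof -
  interpret group G by fact
  obtain B where "bounded_conj_cocycle G q B (\<lambda>g k. d (delta g) (k \<otimes> g))"
    using bounded_derivation_cocycle assms by blast
  then interpret C: bounded_conj_cocycle G q B "\<lambda>g k. d (delta g) (k \<otimes> g)" .
  obtain W where W: "finite W" "W \<subseteq> carrier G"
    "\<And>k h. k \<in> carrier G \<Longrightarrow> finite (conj_class G k) \<Longrightarrow> h \<in> conj_class G k \<Longrightarrow>
      \<exists>w\<in>W. h = conj_by G w k"
    using uniformly_bounded_finite_classes assms by meson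
  obtain y where y: "C.potential y" and sums: "\<And>F. finite F \<Longrightarrow> F \<subseteq> carrier G \<Longrightarrow>
      (\<Sum>k\<in>F. cmod (y k) powr q) \<le> (real (card W) + 1) * B"
    using C.ex_summable_potential[OF bc_group_conjugates_stay_close W] assms by blast
  define x where "x k = (if k \<in> carrier G then y k else 0)" for k
  define R where "R = ((real (card W) + 1) * B) powr (1 / q)"
  have R: "R powr q = (real (card W) + 1) * B"
    using C.bound_nonneg \<open>1 \<le> q\<close> by (simp add: R_def powr_powr)
  have x: "x \<in> vecs (ell G q)"
  proof (rule lp_norm_leI(1)[of _ _ _ R])
    fix F assume F: "finite F" "F \<subseteq> carrier G"
    then have "(\<Sum>k\<in>F. cmod (x k) powr q) = (\<Sum>k\<in>F. cmod (y k) powr q)"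
      by (intro sum.cong) (auto simp: x_def)
    then show "(\<Sum>k\<in>F. cmod (x k) powr q) \<le> R powr q" using sums[OF F] R by simp
  qed (use \<open>1 \<le> q\<close> in \<open>auto simp: x_def R_def\<close>)
  \<comment> \<open>At \<open>k \<otimes> inv g\<close>, which is the conjugate of \<open>inv g \<otimes> k\<close> by \<open>g\<close>, the coboundary equation
    for \<open>y\<close> turns into the formula for an inner derivation.\<close>
  have d_delta: "d (delta g) k = x (k \<otimes> inv g) - x (inv g \<otimes> k)"
    if g: "g \<in> carrier G" and k: "k \<in> carrier G" for g k
  proof -
    have "conj_by G g (inv g \<otimes> k) = k \<otimes> inv g" using g k by (simp add: conj_by_def flip: m_assoc)
    moreover have "d (delta g) (conj_by G g (inv g \<otimes> k) \<otimes> g) =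
        y (conj_by G g (inv g \<otimes> k)) - y (inv g \<otimes> k)"
      using y g k unfolding C.potential_def by simp
    ultimately show ?thesis using g k by (simp add: x_def m_assoc)
  qed
  have "d a k = ract G x a k - lact G a x k" if a: "a \<in> group_ring G" for a k
  proof (cases "k \<in> carrier G")
    case True
    have sub: "\<And>g. a g \<noteq> 0 \<Longrightarrow> g \<in> carrier G" using a by (auto simp: group_ring_def)
    have "d a k = (\<Sum>g | a g \<noteq> 0. a g * d (delta g) k)"
      using assms(9) a by (intro linear_eq_on_group_ring) (auto simp: derivation_def fp_def)
    also have "\<dots> = (\<Sum>g | a g \<noteq> 0. x (k \<otimes> inv g) * a g - a g * x (inv g \<otimes> k))"
      using sub True by (intro sum.cong) (auto simp: d_delta algebra_simps)
    also have "\<dots> = ract G x a k - lact G a x k"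
      using True by (simp add: ract_def lact_def sum_subtractf)
    finally show ?thesis .
  next
    case False
    have "d a \<in> vecs (ell G q)" using assms(9) a by (simp add: derivation_def fp_def)
    then show ?thesis using False by (auto simp: vecs_ell ract_def lact_def)
  qed
  then show ?thesis using x by blast
qed

end
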